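(* For any $\sigma\in\mathfrak S_n$, with $\tau=\Phi(\sigma)$, $$\ell_S(\sigma)=\ell_T(\sigma)+2\big([2,31](\tau)+[41,32](\tau)+B(\tau)\big).$$
   Context: $\ell_S(\sigma)$ is the number of inversions of $\sigma$; $\ell_T(\sigma)=n-(\text{number of cycles of }\sigma)$. The fundamental bijection $\Phi$: write $\sigma$ in cycle notation with each cycle beginning with its largest element and cycles ordered by increasing largest element; erasing parentheses gives the one-line notation of $\Phi(\sigma)$. For $\tau=\Phi(\sigma)$: $[2,31](\tau)$ = number of pairs of positions $i<j$ with $\tau_{j+1}<\tau_i<\tau_j$; $[41,32](\tau)$ = number of pairs $i,j$ with $i+1<j$ and $\tau_{i+1}<\tau_{j+1}<\tau_j<\tau_i$; $B(\tau)$ = number of pairs $i<j$ with $\tau_i<\tau_j<\tau_{j+1}<\sigma(\tau_i)$. *)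

theory Defs
  imports "HOL-Combinatorics.Cycles" "HOL-Combinatorics.Orbits"
begin

text \<open>
  A permutation in \<open>S\<^sub>n\<close> is a function with \<open>\<sigma> permutes {1..n}\<close>.
\<close>

definition len_S :: "nat \<Rightarrow> (nat \<Rightarrow> nat) \<Rightarrow> nat" where
  "len_S n \<sigma> = card {(i, j). 1 \<le> i \<and> i < j \<and> j \<le> n \<and> \<sigma> i > \<sigma> j}"

definition num_cycles :: "nat \<Rightarrow> (nat \<Rightarrow> nat) \<Rightarrow> nat" where
  "num_cycles n \<sigma> = card (orbit \<sigma> ` {1..n})"

text \<open>The subtraction does not truncate: there are at most \<open>n\<close> cycles (fixed points included).\<close>

definition len_T :: "nat \<Rightarrow> (nat \<Rightarrow> nat) \<Rightarrow> nat" where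
  "len_T n \<sigma> = n - num_cycles n \<sigma>"

definition cycle_maxima :: "nat \<Rightarrow> (nat \<Rightarrow> nat) \<Rightarrow> nat list" where
  "cycle_maxima n \<sigma> = sorted_list_of_set (Max ` orbit \<sigma> ` {1..n})"

text \<open>
  \<open>support \<sigma> m\<close> is the library's list \<open>[m, \<sigma> m, \<sigma> (\<sigma> m), \<dots>]\<close> running once
  through the cycle of \<open>m\<close>; it is \<open>[m]\<close> for a fixed point.
\<close>

definition fundamental_word :: "nat \<Rightarrow> (nat \<Rightarrow> nat) \<Rightarrow> nat list" where
  "fundamental_word n \<sigma> = concat (map (support \<sigma>) (cycle_maxima n \<sigma>))"

text \<open>The shift by one is because list positions start at 0.\<close>

definition fundamental_bij :: "nat \<Rightarrow> (nat \<Rightarrow> nat) \<Rightarrow> nat \<Rightarrow> nat" where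
  "fundamental_bij n \<sigma> i = (if i \<in> {1..n} then fundamental_word n \<sigma> ! (i - 1) else i)"

text \<open>The word contains each of \<open>1, \<dots>, n\<close> exactly once, so \<open>fundamental_bij n \<sigma>\<close> lies in \<open>S\<^sub>n\<close>.\<close>

lemma fundamental_word_correct:
  assumes "\<sigma> permutes {1..n}"
  shows "distinct (fundamental_word n \<sigma>)" "set (fundamental_word n \<sigma>) = {1..n}"
proof -
  have p: "permutation \<sigma>"
    using assms permutation_permutes by blast
  have so: "set (support \<sigma> a) = orbit \<sigma> a" for a
    unfolding support_set[OF p] orbit_altdef_permutation[OF p] by auto
  have eqv: "orbit \<sigma> b = orbit \<sigma> a" if "b \<in> orbit \<sigma> a" for a b
    using orbit_cyclic_eq3[OF cyclic_on_orbit'[OF p] that] .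
  have fin: "finite (orbit \<sigma> a)" for a
    by (rule finite_orbit[OF permutation_self_in_orbit[OF p]])
  have mx: "Max (orbit \<sigma> a) \<in> orbit \<sigma> a" for a
    by (rule Max_in[OF fin orbit_nonempty])
  have setM: "set (cycle_maxima n \<sigma>) = Max ` orbit \<sigma> ` {1..n}"
    unfolding cycle_maxima_def by simp
  have maxM: "Max (orbit \<sigma> m) = m" if "m \<in> set (cycle_maxima n \<sigma>)" for m
  proof -
    from that obtain a where "m = Max (orbit \<sigma> a)"
      unfolding setM by blast
    then show ?thesis
      by (simp only: eqv[OF mx])
  qed
  have neq: "orbit \<sigma> a \<inter> orbit \<sigma> b = {}" if "orbit \<sigma> a \<noteq> orbit \<sigma> b" for a b
    using that eqv by blast
  have "set (fundamental_word n \<sigma>) = (\<Union>m\<in>set (cycle_maxima n \<sigma>). orbit \<sigma> m)"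
    unfolding fundamental_word_def set_concat set_map[of "support \<sigma>"] image_image so ..
  also have "\<dots> = (\<Union>a\<in>{1..n}. orbit \<sigma> a)"
    unfolding setM image_image UN_simps(10) eqv[OF mx] ..
  also have "\<dots> = {1..n}"
    using permutes_orbit_subset[OF assms] permutation_self_in_orbit[OF p] by blast
  finally show "set (fundamental_word n \<sigma>) = {1..n}" .
  have inj: "inj_on (support \<sigma>) (set (cycle_maxima n \<sigma>))"
  proof (rule inj_onI)
    fix a b
    assume ab: "a \<in> set (cycle_maxima n \<sigma>)" "b \<in> set (cycle_maxima n \<sigma>)"
      and "support \<sigma> a = support \<sigma> b"
    then have "orbit \<sigma> a = orbit \<sigma> b"
      by (simp only: so[symmetric])
    then show "a = b"
      by (rule trans[OF trans[OF maxM[OF ab(1), symmetric] arg_cong[of _ _ Max]] maxM[OF ab(2)]])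
  qed
  show "distinct (fundamental_word n \<sigma>)"
    unfolding fundamental_word_def
  proof (rule distinct_concat)
    have "distinct (cycle_maxima n \<sigma>)"
      unfolding cycle_maxima_def by simp
    then show "distinct (map (support \<sigma>) (cycle_maxima n \<sigma>))"
      using inj by (simp only: distinct_map[of "support \<sigma>"] simp_thms)
  next
    fix ys assume "ys \<in> set (map (support \<sigma>) (cycle_maxima n \<sigma>))"
    then obtain a where "ys = support \<sigma> a"
      unfolding set_map[of "support \<sigma>"] by blast
    then show "distinct ys"
      by (simp only: cycle_of_permutation[OF p])
  next
    fix ys zs
    assume A: "ys \<in> set (map (support \<sigma>) (cycle_maxima n \<sigma>))"
      "zs \<in> set (map (support \<sigma>) (cycle_maxima n \<sigma>))" "ys \<noteq> zs"
    obtain a where a: "a \<in> set (cycle_maxima n \<sigma>)" "ys = support \<sigma> a"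
      using A(1) unfolding set_map[of "support \<sigma>"] by blast
    obtain b where b: "b \<in> set (cycle_maxima n \<sigma>)" "zs = support \<sigma> b"
      using A(2) unfolding set_map[of "support \<sigma>"] by blast
    have "orbit \<sigma> a \<noteq> orbit \<sigma> b"
    proof
      assume "orbit \<sigma> a = orbit \<sigma> b"
      then have "a = b"
        by (rule trans[OF trans[OF maxM[OF a(1), symmetric] arg_cong[of _ _ Max]] maxM[OF b(1)]])
      then show False
        using A(3) a(2) b(2) by blast
    qed
    then show "set ys \<inter> set zs = {}"
      unfolding a(2) b(2) so by (rule neq)
  qed
qed

lemma fundamental_bij_permutes:
  assumes "\<sigma> permutes {1..n}"
  shows "fundamental_bij n \<sigma> permutes {1..n}"
proof (rule bij_imp_permutes)
  let ?w = "fundamental_word n \<sigma>"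
  note w = fundamental_word_correct[OF assms]
  have len: "length ?w = n"
    using distinct_card[OF w(1)] w(2) by simp
  have "bij_betw (\<lambda>i. i - 1) {1..n} {..<length ?w}"
    unfolding len by (rule bij_betw_byWitness[where f' = Suc]) auto
  from bij_betw_trans[OF this bij_betw_nth[OF w(1) refl refl]]
  have "bij_betw (\<lambda>i. ?w ! (i - 1)) {1..n} {1..n}"
    unfolding w(2) comp_def .
  moreover have "bij_betw (fundamental_bij n \<sigma>) {1..n} {1..n} \<longleftrightarrow>
      bij_betw (\<lambda>i. ?w ! (i - 1)) {1..n} {1..n}"
    by (rule bij_betw_cong) (simp add: fundamental_bij_def)
  ultimately show "bij_betw (fundamental_bij n \<sigma>) {1..n} {1..n}"
    by blast
qed (auto simp: fundamental_bij_def)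

definition pat_2_31 :: "nat \<Rightarrow> (nat \<Rightarrow> nat) \<Rightarrow> nat" where
  "pat_2_31 n \<tau> = card {(i, j). 1 \<le> i \<and> i < j \<and> j + 1 \<le> n \<and>
     \<tau> (j + 1) < \<tau> i \<and> \<tau> i < \<tau> j}"

definition pat_41_32 :: "nat \<Rightarrow> (nat \<Rightarrow> nat) \<Rightarrow> nat" where
  "pat_41_32 n \<tau> = card {(i, j). 1 \<le> i \<and> i + 1 < j \<and> j + 1 \<le> n \<and>
     \<tau> (i + 1) < \<tau> (j + 1) \<and> \<tau> (j + 1) < \<tau> j \<and> \<tau> j < \<tau> i}"

text \<open>
  The statistic \<open>B(\<tau>)\<close> refers to both \<open>\<tau>\<close> and the permutation \<open>\<sigma>\<close> with \<open>\<tau> = \<Phi>(\<sigma>)\<close>; here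
  \<open>\<sigma>\<close> is passed explicitly, and the definition is meaningful for
  \<open>\<tau> = fundamental_bij n \<sigma>\<close>.
\<close>

definition stat_B :: "nat \<Rightarrow> (nat \<Rightarrow> nat) \<Rightarrow> (nat \<Rightarrow> nat) \<Rightarrow> nat" where
  "stat_B n \<sigma> \<tau> = card {(i, j). 1 \<le> i \<and> i < j \<and> j + 1 \<le> n \<and>
     \<tau> i < \<tau> j \<and> \<tau> j < \<tau> (j + 1) \<and> \<tau> (j + 1) < \<sigma> (\<tau> i)}"

end

theory Submission
  imports Defs
begin

text \<open>
  The identity is proved by building the word \<open>\<tau>\<close> letter by letter. A letter exceeding all earlier
  ones opens a new cycle and changes neither side. Otherwise the new letter \<open>e\<close> is inserted into
  the current cycle between the last letter \<open>p\<close> and the maximum \<open>M = \<sigma> p\<close>, and the number of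
  inversions grows by \<open>1 + 2K\<close> with \<open>K = card {x. x < p \<and> e < \<sigma> x}\<close>. If \<open>p < e\<close>, then \<open>K\<close> is
  the growth of \<open>B\<close>. If \<open>e < p\<close>, then, \<open>\<sigma>\<close> being a bijection, \<open>K\<close> is the number of \<open>x\<close> with
  \<open>e < x < p\<close> plus the number of \<open>x > p\<close> with \<open>\<sigma> x < e\<close>, and these are the growths of the other
  two statistics.
\<close>

section \<open>Words with their permutations, and the statistics on words\<close>

text \<open>
  \<open>foata w s c\<close>: the permutation \<open>s\<close> of the letters of \<open>w\<close> has \<open>c\<close> cycles and \<open>\<Phi>(s) = w\<close>.
\<close>

inductive foata :: "'a::linorder list \<Rightarrow> ('a \<Rightarrow> 'a) \<Rightarrow> nat \<Rightarrow> bool" where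
  empty: "foata [] id 0"
| open_cycle: "foata w s c \<Longrightarrow> \<forall>x\<in>set w. x < e \<Longrightarrow> foata (w @ [e]) s (Suc c)"
| extend_cycle: "foata w s c \<Longrightarrow> e \<notin> set w \<Longrightarrow> w \<noteq> [] \<Longrightarrow> e < Max (set w) \<Longrightarrow>
    foata (w @ [e]) (s(last w := e, e := Max (set w))) c"

text \<open>The letters of a prefix of the word need not form an initial interval, so inversions are
  counted over an arbitrary set.\<close>

definition inv_on :: "'a::linorder set \<Rightarrow> ('a \<Rightarrow> 'a) \<Rightarrow> nat" where
  "inv_on A s = card {(x, y). x \<in> A \<and> y \<in> A \<and> x < y \<and> s y < s x}"

text \<open>A shared index range, with positions from 0, lets one lemma treat the growth of all
  three statistics.\<close>

definition pairs :: "nat \<Rightarrow> (nat \<Rightarrow> nat \<Rightarrow> bool) \<Rightarrow> (nat \<times> nat) set" where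
  "pairs L Q = {(i, j). i < j \<and> Suc j < L \<and> Q i j}"

definition word_2_31 :: "'a::linorder list \<Rightarrow> nat" where
  "word_2_31 w = card (pairs (length w) (\<lambda>i j. w ! Suc j < w ! i \<and> w ! i < w ! j))"

definition word_41_32 :: "'a::linorder list \<Rightarrow> nat" where
  "word_41_32 w = card (pairs (length w)
     (\<lambda>i j. w ! Suc i < w ! Suc j \<and> w ! Suc j < w ! j \<and> w ! j < w ! i))"

definition word_B :: "'a::linorder list \<Rightarrow> ('a \<Rightarrow> 'a) \<Rightarrow> nat" where
  "word_B w s = card (pairs (length w)
     (\<lambda>i j. w ! i < w ! j \<and> w ! j < w ! Suc j \<and> w ! Suc j < s (w ! i)))"

section \<open>Growth of pattern counts when a letter is appended\<close>

lemma finite_pairs: "finite (pairs L Q)"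
  by (rule finite_subset[of _ "{..<L} \<times> {..<L}"]) (auto simp: pairs_def)

lemma card_pairs_Suc:
  "card (pairs (Suc L) Q) = card (pairs L Q) + card {i. Suc i < L \<and> Q i (L - 1)}"
proof -
  let ?N = "(\<lambda>i. (i, L - 1)) ` {i. Suc i < L \<and> Q i (L - 1)}"
  have "pairs (Suc L) Q = pairs L Q \<union> ?N"
    by (auto simp: pairs_def image_iff less_Suc_eq)
  moreover have "pairs L Q \<inter> ?N = {}" by (auto simp: pairs_def)
  moreover have "finite ?N"
    by (rule finite_imageI, rule finite_subset[of _ "{..<L}"]) auto
  moreover have "card ?N = card {i. Suc i < L \<and> Q i (L - 1)}"
    by (rule card_image) (auto simp: inj_on_def)
  ultimately show ?thesis by (simp add: card_Un_disjoint finite_pairs)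
qed

text \<open>In each new pair \<open>j\<close> is the position of \<open>last w\<close>, and
  \<open>i\<close> is an earlier position, determined by its letter because \<open>w\<close> is
  distinct. Counting letters instead of positions makes the growth comparable with
  inversions.\<close>

lemma card_pairs_snoc:
  assumes "distinct w" "w \<noteq> []"
    and old: "\<And>i j. i < j \<Longrightarrow> Suc j < length w \<Longrightarrow> Q' i j \<longleftrightarrow> Q i j"
    and new: "\<And>i. Suc i < length w \<Longrightarrow> Q' i (length w - 1) \<longleftrightarrow> P (w ! i)"
  shows "card (pairs (length (w @ [e])) Q') =
    card (pairs (length w) Q) + card {x \<in> set w - {last w}. P x}"
proof -
  have "{x \<in> set w - {last w}. P x} = (!) w ` {i. Suc i < length w \<and> Q' i (length w - 1)}"
    (is "?X = _ ` ?I")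
  proof
    have "\<exists>i. x = w ! i \<and> Suc i < length w" if "x \<in> set w - {last w}" for x
    proof -
      from that obtain i where i: "i < length w" "x = w ! i" by (auto simp: in_set_conv_nth)
      moreover from this that have "i \<noteq> length w - 1" using assms(2) by (auto simp: last_conv_nth)
      ultimately show ?thesis by (intro exI[of _ i]) auto
    qed
    then show "?X \<subseteq> (!) w ` ?I" using new by blast
    show "(!) w ` ?I \<subseteq> ?X"
      using new assms(1,2) by (auto simp: last_conv_nth nth_eq_iff_index_eq)
  qed
  moreover have "inj_on ((!) w) ?I"
    using assms(1) by (auto simp: inj_on_def nth_eq_iff_index_eq)
  moreover have "pairs (length w) Q' = pairs (length w) Q"
    using old by (auto simp: pairs_def)
  ultimately show ?thesis by (simp add: card_pairs_Suc card_image)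
qed

lemma word_2_31_snoc:
  assumes "distinct w" "w \<noteq> []"
  shows "word_2_31 (w @ [e]) = word_2_31 w +
    card {x \<in> set w - {last w}. e < x \<and> x < last w}"
  unfolding word_2_31_def using assms
  by (intro card_pairs_snoc) (auto simp: nth_append last_conv_nth)

lemma word_B_snoc:
  assumes "distinct w" "w \<noteq> []" and s: "\<And>x. x \<in> set w \<Longrightarrow> x \<noteq> last w \<Longrightarrow> s' x = s x"
  shows "word_B (w @ [e]) s' = word_B w s +
    card {x \<in> set w - {last w}. x < last w \<and> last w < e \<and> e < s x}"
proof -
  \<comment> \<open>Only positions before the last one occur as \<open>i\<close>, so redefining the
    permutation at \<open>last w\<close> is harmless.\<close>
  have "s' (w ! i) = s (w ! i)" if "Suc i < length w" for i
    using that assms by (intro s) (auto simp: last_conv_nth nth_eq_iff_index_eq)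
  then show ?thesis
    unfolding word_B_def using assms(1,2)
    by (intro card_pairs_snoc) (auto simp: nth_append last_conv_nth)
qed

lemma card_pairs_cong:
  "(\<And>i j. i < j \<Longrightarrow> Suc j < L \<Longrightarrow> Q i j \<longleftrightarrow> Q' i j) \<Longrightarrow> card (pairs L Q) = card (pairs L Q')"
  unfolding pairs_def by (rule arg_cong[where f = card]) auto

section \<open>Cycles as seen in the word\<close>

text \<open>The last letter ends the current cycle, and the letter that opened this cycle is the
  largest so far; so \<open>s\<close> sends the last letter to the maximum.\<close>

lemma foata_invariants:
  "foata w s c \<Longrightarrow> s permutes set w \<and> distinct w \<and> (w \<noteq> [] \<longrightarrow> s (last w) = Max (set w))"
proof (induction rule: foata.induct)
  case (open_cycle w s c e)
  then have "e \<notin> set w" by auto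
  moreover have "Max (insert e (set w)) = e"
    using open_cycle by (intro Max_eqI) auto
  ultimately show ?case
    using open_cycle by (auto intro: permutes_subset permutes_not_in)
next
  case (extend_cycle w s c e)
  then have IH: "s permutes set w" "distinct w" "s (last w) = Max (set w)" by auto
  have "s e = e" using IH extend_cycle(2) by (auto intro: permutes_not_in)
  \<comment> \<open>Since \<open>s\<close> fixes the new letter \<open>e\<close>, inserting
    \<open>e\<close> after \<open>last w\<close> is composition with a transposition.\<close>
  then have "s(last w := e, e := Max (set w)) = s \<circ> transpose (last w) e"
    using IH by (auto simp: fun_eq_iff transpose_def)
  moreover have "s \<circ> transpose (last w) e permutes set (w @ [e])"
    using IH extend_cycle by (intro permutes_compose permutes_swap_id) (auto intro: permutes_subset)
  moreover have "Max (insert e (set w)) = Max (set w)"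
    using extend_cycle by (subst Max_insert) auto
  moreover have "(s \<circ> transpose (last w) e) e = Max (set w)" using IH by simp
  ultimately show ?case using IH extend_cycle(2) by (auto simp del: o_apply)
qed (simp add: permutes_def)

text \<open>
  In the second case a cycle ends at position \<open>i\<close>; hence descents of \<open>w\<close> are exactly the
  strict anti-excedances of \<open>s\<close>.
\<close>

lemma foata_step:
  assumes "foata w s c" "Suc i < length w"
  shows "s (w ! i) = w ! Suc i \<or> w ! i \<le> s (w ! i) \<and> w ! i < w ! Suc i"
  using assms
proof (induction rule: foata.induct)
  case (open_cycle w s c e)
  show ?case
  proof (cases "Suc i < length w")
    case True
    then show ?thesis using open_cycle by (simp add: nth_append)
  next
    case False
    then have i: "Suc i = length w" using open_cycle by simp
    then have "w \<noteq> []" by auto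
    then have l: "w ! i = last w" "w \<noteq> []"
      using i by (auto simp: last_conv_nth simp flip: i)
    \<comment> \<open>The finished cycle returns to its maximum while \<open>e\<close> exceeds all
      letters, which gives the second alternative.\<close>
    then have "s (last w) = Max (set w)"
      using foata_invariants[OF open_cycle(1)] by simp
    then show ?thesis using i l open_cycle by (simp add: nth_append)
  qed
next
  case (extend_cycle w s c e)
  have d: "distinct w" using foata_invariants[OF extend_cycle(1)] by simp
  show ?case
  proof (cases "Suc i < length w")
    case True
    then have "w ! i \<noteq> e" "w ! i \<noteq> last w"
      using extend_cycle d by (auto simp: last_conv_nth nth_eq_iff_index_eq)
    then show ?thesis using True extend_cycle by (simp add: nth_append)
  next
    case False
    then have i: "Suc i = length w" using extend_cycle by simp
    then have l: "w ! i = last w" "w ! i \<in> set w" using extend_cycle(3) by (auto simp: last_conv_nth simp flip: i)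
    then show ?thesis using i extend_cycle(2) by (auto simp add: nth_append)
  qed
qed simp

text \<open>The pattern speaks of the letter after \<open>x\<close>, the count of
  \<open>s x\<close>. By \<open>foata_step\<close> they can differ only if the next letter exceeds
  \<open>x\<close> and \<open>s x\<close> is at least \<open>x\<close>; then
  \<open>e < last w < x\<close> makes both conditions fail.\<close>

lemma word_41_32_snoc:
  assumes f: "foata w s c" and "w \<noteq> []"
  shows "word_41_32 (w @ [e]) = word_41_32 w +
    card {x \<in> set w - {last w}. s x < e \<and> e < last w \<and> last w < x}"
proof -
  have "w ! Suc i < e \<and> e < last w \<and> last w < w ! i \<longleftrightarrow>
      s (w ! i) < e \<and> e < last w \<and> last w < w ! i" if "Suc i < length w" for i
    using foata_step[OF f that] by auto
  then show ?thesis
    unfolding word_41_32_def using assms(2) foata_invariants[OF f]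
    by (intro card_pairs_snoc) (auto simp: nth_append last_conv_nth)
qed

section \<open>Inversions when a cycle is extended\<close>

lemma inv_on_insert:
  assumes "finite B" "z \<notin> B"
  shows "inv_on (insert z B) s = inv_on B s +
    card {x \<in> B. x < z \<and> s z < s x} + card {y \<in> B. z < y \<and> s y < s z}"
proof -
  let ?I = "{(x, y). x \<in> B \<and> y \<in> B \<and> x < y \<and> s y < s x}"
  let ?L = "(\<lambda>x. (x, z)) ` {x \<in> B. x < z \<and> s z < s x}"
  let ?R = "(\<lambda>y. (z, y)) ` {y \<in> B. z < y \<and> s y < s z}"
  have "{(x, y). x \<in> insert z B \<and> y \<in> insert z B \<and> x < y \<and> s y < s x} = (?I \<union> ?L) \<union> ?R"
    using assms by auto
  moreover have "finite ?I"
    by (rule finite_subset[of _ "B \<times> B"]) (use assms in auto)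
  moreover have "card ?L = card {x \<in> B. x < z \<and> s z < s x}"
    "card ?R = card {y \<in> B. z < y \<and> s y < s z}"
    by (rule card_image, auto simp: inj_on_def)+
  moreover have "card ((?I \<union> ?L) \<union> ?R) = card ?I + card ?L + card ?R"
  proof (subst card_Un_disjoint)
    show "card (?I \<union> ?L) + card ?R = card ?I + card ?L + card ?R"
      using \<open>finite ?I\<close> assms by (subst card_Un_disjoint) auto
  qed (use \<open>finite ?I\<close> assms in auto)
  ultimately show ?thesis by (simp add: inv_on_def)
qed

lemma inv_on_cong: "(\<And>x. x \<in> A \<Longrightarrow> s x = s' x) \<Longrightarrow> inv_on A s = inv_on A s'"
  unfolding inv_on_def by (rule arg_cong[where f = card]) auto

lemma card_filter_split:
  assumes "finite B"
    and "\<And>x. x \<in> B \<Longrightarrow> P x \<longleftrightarrow> Q x \<or> R x" "\<And>x. x \<in> B \<Longrightarrow> \<not> (Q x \<and> R x)"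
  shows "card {x \<in> B. P x} = card {x \<in> B. Q x} + card {x \<in> B. R x}"
proof -
  have "{x \<in> B. P x} = {x \<in> B. Q x} \<union> {x \<in> B. R x}"
    using assms by auto
  then show ?thesis using assms by (simp add: card_Un_disjoint disjoint_iff)
qed

text \<open>On \<open>B = A - {p}\<close> nothing changes. Before the step \<open>p\<close> has the
  maximal value, hence is in \<open>H + J\<close> inversions. Afterwards \<open>p\<close> has value
  \<open>e\<close> and is in \<open>K + J\<close> inversions with \<open>B\<close>, while
  \<open>e\<close> has the maximal value and is in \<open>Suc (K + H)\<close> inversions. The
  difference is \<open>1 + 2 * K\<close>.\<close>

lemma inv_on_extend_cycle:
  fixes s :: "'a::linorder \<Rightarrow> 'a"
  assumes s: "s permutes A" and "finite A" and p: "p \<in> A" "s p = Max A" and e: "e \<notin> A" "e < Max A"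
  defines "s' \<equiv> s(p := e, e := Max A)"
  shows "inv_on (insert e A) s' = Suc (inv_on A s + 2 * card {x \<in> A - {p}. x < p \<and> e < s x})"
    and "card {x \<in> A - {p}. x < p \<and> e < s x} =
      card {x \<in> A - {p}. e < x \<and> x < p} + card {x \<in> A - {p}. s x < e \<and> e < p \<and> p < x} +
      card {x \<in> A - {p}. x < p \<and> p < e \<and> e < s x}"
proof -
  define B where "B = A - {p}"
  let ?M = "Max A"
  have A: "A = insert p B" and pB: "p \<notin> B" and finB: "finite B" and eB: "e \<notin> B" and ep: "e \<noteq> p"
    using assms by (auto simp: B_def)
  have bij: "bij_betw s B (A - {?M})"
    using permutes_inj_on[OF s, of A] permutes_image[OF s] p
    by (auto simp: B_def bij_betw_def inj_on_image_set_diff[of s A] intro: inj_on_subset)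
  have sB: "s x \<in> A" "s x < ?M" "s x \<noteq> e" if "x \<in> B" for x
  proof -
    have *: "s x \<in> A - {?M}" using bij that by (auto simp: bij_betw_def)
    then show "s x \<in> A" "s x \<noteq> e" using e by auto
    show "s x < ?M" using * \<open>finite A\<close> by (auto simp: less_le)
  qed
  have s'B: "s' x = s x" if "x \<in> B" for x
    using that pB eB by (auto simp: s'_def)
  have s'p: "s' p = e" "s' e = ?M" using ep by (auto simp: s'_def)
  have MA: "?M \<in> A" using p \<open>finite A\<close> by (intro Max_in) auto
  have neq: "x < p \<or> p < x" if "x \<in> B" for x using that pB by (metis neqE)
  define K where "K = card {x \<in> B. x < p \<and> e < s x}"
  define H where "H = card {y \<in> B. p < y \<and> e < s y}"
  define J where "J = card {y \<in> B. p < y \<and> s y < e}"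
  \<comment> \<open>Counting values instead of arguments: \<open>s\<close> maps \<open>B\<close>
    onto \<open>A\<close> without its maximum.\<close>
  have KH: "K + H = card {z \<in> A - {?M}. e < z}"
  proof -
    have "K + H = card {x \<in> B. e < s x}"
      unfolding K_def H_def using finB neq by (intro card_filter_split[symmetric]) (auto dest: less_asym)
    also have "\<dots> = card (s ` {x \<in> B. e < s x})"
      using bij by (intro card_image[symmetric]) (auto simp: bij_betw_def inj_on_def)
    also have "s ` {x \<in> B. e < s x} = {z \<in> A - {?M}. e < z}"
      using bij by (auto simp: bij_betw_def)
    finally show ?thesis .
  qed
  \<comment> \<open>The maximum itself lies above \<open>e\<close>; this is the source of the odd
    unit.\<close>
  also have "Suc (card {z \<in> A - {?M}. e < z}) = card {z \<in> A. e < z}"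
  proof -
    have "{z \<in> A. e < z} = insert ?M {z \<in> A - {?M}. e < z}" using MA e by auto
    then show ?thesis using \<open>finite A\<close> by simp
  qed
  ultimately have G: "card {z \<in> A. e < z} = Suc (K + H)" by simp
  have "s y < e \<or> e < s y" if "y \<in> B" for y using sB(3)[OF that] by (metis neqE)
  then have HJ: "card {y \<in> B. p < y} = H + J"
    unfolding H_def J_def using finB by (intro card_filter_split) (auto dest: less_asym)
  have s'_less: "s' x < ?M" if "x \<in> A" for x
    using that sB(2)[of x] s'B[of x] s'p(1) e(2) unfolding A by (cases "x = p") simp_all
  have "inv_on A s = inv_on B s + card {y \<in> B. p < y}"
  proof -
    have "{x \<in> B. x < p \<and> s p < s x} = {}" "{y \<in> B. p < y \<and> s y < s p} = {y \<in> B. p < y}"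
      using sB p by (auto dest: less_asym)
    then show ?thesis unfolding A inv_on_insert[OF finB pB, of s] by (simp only: card.empty add_0_right)
  qed
  moreover have "inv_on (insert e A) s' = inv_on B s + K + J + card {z \<in> A. e < z}"
  proof -
    have "{x \<in> A. x < e \<and> s' e < s' x} = {}" "{y \<in> A. e < y \<and> s' y < s' e} = {y \<in> A. e < y}"
      using s'_less by (auto simp: s'p dest: less_asym)
    then have "inv_on (insert e A) s' = inv_on A s' + card {z \<in> A. e < z}"
      unfolding inv_on_insert[OF \<open>finite A\<close> e(1), of s'] by (simp only: card.empty add_0_right)
    also have "inv_on A s' = inv_on B s' + card {x \<in> B. x < p \<and> s' p < s' x} +
        card {y \<in> B. p < y \<and> s' y < s' p}"
      unfolding A by (rule inv_on_insert[OF finB pB])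
    also have "{x \<in> B. x < p \<and> s' p < s' x} = {x \<in> B. x < p \<and> e < s x}"
      using s'B s'p by auto
    also have "{y \<in> B. p < y \<and> s' y < s' p} = {y \<in> B. p < y \<and> s y < e}"
      using s'B s'p by auto
    also have "inv_on B s' = inv_on B s" using s'B by (rule inv_on_cong)
    finally show ?thesis by (simp add: K_def J_def)
  qed
  ultimately show "inv_on (insert e A) s' = Suc (inv_on A s + 2 * card {x \<in> A - {p}. x < p \<and> e < s x})"
    using G HJ unfolding K_def B_def by simp
  have "K = card {x \<in> B. e < x \<and> x < p} + card {x \<in> B. s x < e \<and> e < p \<and> p < x} +
      card {x \<in> B. x < p \<and> p < e \<and> e < s x}"
  proof (cases "e < p")
    case True
    \<comment> \<open>Removing \<open>p\<close> leaves \<open>K + H\<close> letters of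
      \<open>B\<close> above \<open>e\<close>. Splitting them at \<open>p\<close> and using
      \<open>H + J\<close> for those above \<open>p\<close> cancels \<open>H\<close>, so
      \<open>K\<close> is \<open>J\<close> plus the number of letters between \<open>e\<close> and
      \<open>p\<close>.\<close>
    have "{z \<in> A. e < z} = insert p {z \<in> B. e < z}" using True unfolding A by auto
    then have "card {z \<in> B. e < z} = K + H" using G finB pB by simp
    moreover have "card {z \<in> B. e < z} = card {z \<in> B. e < z \<and> z < p} + card {z \<in> B. p < z}"
      using finB neq True by (intro card_filter_split) (auto dest: less_asym intro: less_trans[OF True])
    moreover have e: "{x \<in> B. s x < e \<and> e < p \<and> p < x} = {y \<in> B. p < y \<and> s y < e}"
      "{x \<in> B. x < p \<and> p < e \<and> e < s x} = {}" using True by auto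
    ultimately show ?thesis unfolding e card.empty using HJ by (simp add: J_def)
  next
    case False
    then have e: "{x \<in> B. x < p \<and> p < e \<and> e < s x} = {x \<in> B. x < p \<and> e < s x}"
      "{x \<in> B. s x < e \<and> e < p \<and> p < x} = {}" "{x \<in> B. e < x \<and> x < p} = {}"
      using ep by auto
    show ?thesis unfolding e by (simp add: K_def)
  qed
  then show "card {x \<in> A - {p}. x < p \<and> e < s x} =
      card {x \<in> A - {p}. e < x \<and> x < p} + card {x \<in> A - {p}. s x < e \<and> e < p \<and> p < x} +
      card {x \<in> A - {p}. x < p \<and> p < e \<and> e < s x}"
    by (simp add: K_def B_def)
qed

section \<open>The identity for every word so built\<close>

text \<open>With \<open>length w - c\<close> as reflection length this is the claimed identity;
  \<open>c\<close> stands on the left to avoid truncated subtraction.\<close>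

lemma foata_inv:
  "foata w s c \<Longrightarrow> inv_on (set w) s + c = length w + 2 * (word_2_31 w + word_41_32 w + word_B w s)"
proof (induction rule: foata.induct)
  case empty
  then show ?case by (simp add: inv_on_def word_2_31_def word_41_32_def word_B_def pairs_def)
next
  case (open_cycle w s c e)
  have d: "distinct w" and s: "s permutes set w"
    using foata_invariants[OF open_cycle(1)] by auto
  have e: "e \<notin> set w" using open_cycle by auto
  then have se: "s e = e" using s by (auto intro: permutes_not_in)
  \<comment> \<open>A new fixed point above all letters is in no inversion; \<open>c\<close> and the
    length both grow by one.\<close>
  have "inv_on (set (w @ [e])) s = inv_on (set w) s"
  proof -
    have "{x \<in> set w. x < e \<and> s e < s x} = {}" "{y \<in> set w. e < y \<and> s y < s e} = {}"
      using open_cycle(2) permutes_in_image[OF s] by (auto simp: se dest: less_asym)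
    then show ?thesis
      using inv_on_insert[of "set w" e s] e
      by (simp only: card.empty list.set set_append Un_insert_right Un_empty_right add_0_right
          not_False_eq_True finite_set)
  qed
  moreover have "word_2_31 (w @ [e]) + word_41_32 (w @ [e]) + word_B (w @ [e]) s =
    word_2_31 w + word_41_32 w + word_B w s"
  proof (cases "w = []")
    case False
    then have "{x \<in> set w - {last w}. e < x \<and> x < last w} = {}"
      "{x \<in> set w - {last w}. s x < e \<and> e < last w \<and> last w < x} = {}"
      "{x \<in> set w - {last w}. x < last w \<and> last w < e \<and> e < s x} = {}"
      using open_cycle(2) permutes_in_image[OF s] by (auto dest: less_asym)
    then show ?thesis
      by (simp only: word_2_31_snoc[OF d False] word_41_32_snoc[OF open_cycle(1) False]
          word_B_snoc[OF d False refl] card.empty)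
  qed (simp add: word_2_31_def word_41_32_def word_B_def pairs_def)
  ultimately show ?case using open_cycle(3) by simp
next
  case (extend_cycle w s c e)
  let ?s' = "s(last w := e, e := Max (set w))"
  have d: "distinct w" and s: "s permutes set w" and l: "s (last w) = Max (set w)"
    using foata_invariants[OF extend_cycle(1)] extend_cycle(3) by auto
  have B: "word_B (w @ [e]) ?s' = word_B w s +
    card {x \<in> set w - {last w}. x < last w \<and> last w < e \<and> e < s x}"
    using d extend_cycle(2,3) by (intro word_B_snoc) auto
  have lw: "last w \<in> set w" using extend_cycle(3) by simp
  \<comment> \<open>Here \<open>b\<close> is the old number of inversions, \<open>u\<close>,
    \<open>v\<close>, \<open>t\<close> are the old statistics, and \<open>x\<close>,
    \<open>y\<close>, \<open>z\<close> their growths, with sum \<open>K\<close>.\<close>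
  have arith: "a + c = l + length [e] + 2 * (u + x + (v + y) + (t + z))"
    if "a = Suc (b + 2 * (x + y + z))" "b + c = l + 2 * (u + v + t)" for a b l u v t x y z
    using that by simp
  have "inv_on (set (w @ [e])) ?s' = Suc (inv_on (set w) s +
      2 * card {x \<in> set w - {last w}. x < last w \<and> e < s x})"
    using inv_on_extend_cycle(1)[OF s finite_set lw l extend_cycle(2,4)]
    by (simp only: set_append list.set Un_insert_right Un_empty_right)
  then show ?case
    unfolding inv_on_extend_cycle(2)[OF s finite_set lw l extend_cycle(2,4)]
      word_2_31_snoc[OF d extend_cycle(3)] word_41_32_snoc[OF extend_cycle(1,3)] B length_append
    using extend_cycle.IH by (rule arith)
qed

section \<open>The fundamental word arises in this way\<close>

lemma orbit_eq:
  assumes "permutation \<sigma>" "y \<in> orbit \<sigma> x"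
  shows "orbit \<sigma> y = orbit \<sigma> x"
  using orbit_cyclic_eq3[OF cyclic_on_orbit'[OF assms(1)] assms(2)] .

lemma finite_orbit_permutation: "permutation \<sigma> \<Longrightarrow> finite (orbit \<sigma> x)"
  by (rule finite_orbit[OF permutation_self_in_orbit])

lemma set_support: "permutation \<sigma> \<Longrightarrow> set (support \<sigma> x) = orbit \<sigma> x"
  unfolding support_set orbit_altdef_permutation by auto

text \<open>The maximum \<open>m\<close> opens a cycle, and its further images are new letters below
  \<open>m\<close>, so each extends it. The last letter is sent to \<open>m\<close> by
  \<open>foata_invariants\<close>, as \<sigma> requires.\<close>

lemma foata_support:
  assumes p: "permutation \<sigma>" and m: "Max (orbit \<sigma> m) = m"
    and W: "foata W s c" "\<And>x. x \<in> set W \<Longrightarrow> x < m" "set W \<inter> orbit \<sigma> m = {}"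
  shows "\<exists>s'. foata (W @ support \<sigma> m) s' (Suc c) \<and> (\<forall>x\<in>set W. s' x = s x) \<and>
    (\<forall>x\<in>orbit \<sigma> m. s' x = \<sigma> x)"
proof -
  define f where "f i = (\<sigma> ^^ i) m" for i
  define L where "L = least_power \<sigma> m"
  have f0: "f 0 = m" and fSuc: "\<sigma> (f i) = f (Suc i)" for i by (simp_all add: f_def)
  have L: "L > 0" "f L = m"
    using least_power_of_permutation[OF p] by (simp_all add: L_def f_def)
  have supp: "support \<sigma> m = map f [0..<L]" by (simp add: f_def[abs_def] L_def)
  have inj: "f i = f j \<longleftrightarrow> i = j" if "i < L" "j < L" for i j
  proof -
    have "distinct (map f [0..<L])" using cycle_of_permutation[OF p, of m] supp by simp
    then show ?thesis using that by (auto simp: distinct_map inj_on_def)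
  qed
  have forb: "f i \<in> orbit \<sigma> m" for i
    unfolding orbit_altdef_permutation[OF p] by (auto simp: f_def)
  then have fm: "f i \<le> m" for i
    using Max_ge[OF finite_orbit_permutation[OF p] forb[of i]] m by simp
  have fW: "f i \<notin> set W" for i using W(3) forb by auto
  have Max_w: "Max (set (W @ map f [0..<Suc k])) = m" for k
  proof (rule Max_eqI)
    have "f 0 \<in> f ` {0..<Suc k}" by (rule imageI) simp
    then show "m \<in> set (W @ map f [0..<Suc k])" by (simp only: f0 set_append set_map set_upt Un_iff simp_thms)
  qed (use W(2) fm less_imp_le in auto)
  \<comment> \<open>Agreement with \<sigma> is claimed for \<open>i < k\<close> only: the last
    letter read, \<open>f k\<close>, points back to \<open>m\<close> until the next one is
    inserted.\<close>
  have "\<exists>s'. foata (W @ map f [0..<Suc k]) s' (Suc c) \<and> (\<forall>x\<in>set W. s' x = s x) \<and>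
      (\<forall>i<k. s' (f i) = f (Suc i))" if "k < L" for k
    using that
  proof (induction k)
    case 0
    then show ?case using foata.open_cycle[OF W(1), of m] W(2) by (auto simp: f0)
  next
    case (Suc k)
    let ?w = "W @ map f [0..<Suc k]" and ?e = "f (Suc k)"
    obtain s' where s': "foata ?w s' (Suc c)" "\<forall>x\<in>set W. s' x = s x" "\<forall>i<k. s' (f i) = f (Suc i)"
      using Suc by auto
    have e: "?e \<notin> set ?w" using fW inj Suc.prems by auto
    have "?e \<noteq> f 0" using inj[of "Suc k" 0] Suc.prems by simp
    then have "?e < Max (set ?w)" using fm[of "Suc k"] unfolding Max_w by (simp add: f0)
    with e s'(1) have "foata (?w @ [?e]) (s'(last ?w := ?e, ?e := Max (set ?w))) (Suc c)"
      by (intro foata.extend_cycle) auto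
    moreover have "?w @ [?e] = W @ map f [0..<Suc (Suc k)]" "last ?w = f k" by simp_all
    ultimately have "foata (W @ map f [0..<Suc (Suc k)]) (s'(f k := ?e, ?e := m)) (Suc c)"
      by (simp only: Max_w)
    moreover have "(s'(f k := ?e, ?e := m)) x = s x" if "x \<in> set W" for x
      using that s'(2) fW by auto
    moreover have "(s'(f k := ?e, ?e := m)) (f i) = f (Suc i)" if "i < Suc k" for i
      using that s'(3) inj Suc.prems by (auto simp: less_Suc_eq)
    ultimately show ?case by blast
  qed
  from this[of "L - 1"] L(1) obtain s' where s': "foata (W @ map f [0..<L]) s' (Suc c)"
      "\<forall>x\<in>set W. s' x = s x" "\<forall>i<L - 1. s' (f i) = f (Suc i)"
    by auto
  have "last (W @ map f [0..<L]) = f (L - 1)" using L(1) by (simp add: last_map)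
  then have "s' (f (L - 1)) = Max (set (W @ map f [0..<L]))"
    using foata_invariants[OF s'(1)] L(1) by auto
  then have "s' (f (L - 1)) = f L" using Max_w[of "L - 1"] L by simp
  then have "s' (f i) = \<sigma> (f i)" if "i < L" for i
    using that s'(3) fSuc by (cases "i = L - 1") auto
  then have "\<forall>x\<in>orbit \<sigma> m. s' x = \<sigma> x"
    unfolding set_support[OF p, symmetric] supp by auto
  then show ?thesis using s' supp by auto
qed

text \<open>Cycles are appended in increasing order of their maxima. All earlier letters lie below
  the new maximum, and the new orbit is disjoint from the earlier ones because equal orbits have
  equal maxima.\<close>

lemma foata_concat_support:
  assumes p: "permutation \<sigma>"
    and "sorted_wrt (<) ms" "\<And>m. m \<in> set ms \<Longrightarrow> Max (orbit \<sigma> m) = m"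
  shows "\<exists>s. foata (concat (map (support \<sigma>) ms)) s (length ms) \<and>
    (\<forall>x\<in>(\<Union>m\<in>set ms. orbit \<sigma> m). s x = \<sigma> x)"
  using assms(2,3)
proof (induction ms rule: rev_induct)
  case Nil
  show ?case using foata.empty by auto
next
  case (snoc m ms)
  let ?W = "concat (map (support \<sigma>) ms)"
  have setW: "set ?W = (\<Union>m\<in>set ms. orbit \<sigma> m)"
    unfolding set_concat set_map[of "support \<sigma>"] image_image set_support[OF p] ..
  obtain s where s: "foata ?W s (length ms)" "\<forall>x\<in>(\<Union>m\<in>set ms. orbit \<sigma> m). s x = \<sigma> x"
    using snoc by (force simp: sorted_wrt_append)
  have less: "m' < m" if "m' \<in> set ms" for m'
    using snoc.prems(1) that by (auto simp: sorted_wrt_append)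
  have W1: "x < m" if x: "x \<in> set ?W" for x
  proof -
    obtain m' where m': "m' \<in> set ms" "x \<in> orbit \<sigma> m'" using x unfolding setW by blast
    then have "x \<le> m'"
      using Max_ge[OF finite_orbit_permutation[OF p] m'(2)] snoc.prems(2)[of m'] by simp
    then show ?thesis using less[OF m'(1)] by simp
  qed
  have max_m: "Max (orbit \<sigma> m) = m" using snoc.prems(2)[of m] by simp
  have W2: "set ?W \<inter> orbit \<sigma> m = {}"
  proof (rule ccontr)
    assume "set ?W \<inter> orbit \<sigma> m \<noteq> {}"
    then obtain m' x where m': "m' \<in> set ms" "x \<in> orbit \<sigma> m'" "x \<in> orbit \<sigma> m"
      unfolding setW by blast
    then have "orbit \<sigma> m' = orbit \<sigma> m" using orbit_eq[OF p] by metis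
    moreover have "Max (orbit \<sigma> m') = m'" using snoc.prems(2)[of m'] m'(1) by simp
    ultimately have "m' = m" using max_m by metis
    then show False using less[OF m'(1)] by simp
  qed
  have "\<exists>s'. foata (?W @ support \<sigma> m) s' (Suc (length ms)) \<and> (\<forall>x\<in>set ?W. s' x = s x) \<and>
      (\<forall>x\<in>orbit \<sigma> m. s' x = \<sigma> x)"
    by (rule foata_support[OF p max_m s(1) _ W2]) (rule W1)
  then obtain s' where s': "foata (?W @ support \<sigma> m) s' (Suc (length ms))" "\<forall>x\<in>set ?W. s' x = s x"
      "\<forall>x\<in>orbit \<sigma> m. s' x = \<sigma> x"
    by (elim exE conjE)
  have "s' x = \<sigma> x" if "x \<in> (\<Union>m\<in>set (ms @ [m]). orbit \<sigma> m)" for x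
    using that s(2) s'(2,3) unfolding setW by (simp del: UN_simps) metis
  moreover have "concat (map (support \<sigma>) (ms @ [m])) = ?W @ support \<sigma> m"
    by (simp only: map_append concat_append list.map concat.simps append_Nil2)
  moreover have "length (ms @ [m]) = Suc (length ms)" by simp
  ultimately show ?case using s'(1) by (simp only:) blast
qed

lemma foata_fundamental_word:
  assumes \<sigma>: "\<sigma> permutes {1..n}"
  shows "foata (fundamental_word n \<sigma>) \<sigma> (num_cycles n \<sigma>)"
proof -
  have p: "permutation \<sigma>" using \<sigma> permutation_permutes by blast
  have mx: "Max (orbit \<sigma> a) \<in> orbit \<sigma> a" for a
    by (rule Max_in[OF finite_orbit_permutation[OF p] orbit_nonempty])
  have setM: "set (cycle_maxima n \<sigma>) = Max ` orbit \<sigma> ` {1..n}"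
    by (simp add: cycle_maxima_def)
  \<comment> \<open>Distinct cycles have distinct maxima, so the list of maxima has one entry per
    cycle.\<close>
  have "inj_on Max (orbit \<sigma> ` {1..n})"
    by (rule inj_onI) (metis imageE mx orbit_eq[OF p])
  then have len: "length (cycle_maxima n \<sigma>) = num_cycles n \<sigma>"
    by (simp add: cycle_maxima_def num_cycles_def card_image)
  have "sorted_wrt (<) (cycle_maxima n \<sigma>)"
    by (simp add: cycle_maxima_def)
  moreover have "Max (orbit \<sigma> m) = m" if "m \<in> set (cycle_maxima n \<sigma>)" for m
    using that orbit_eq[OF p mx] unfolding setM by auto
  ultimately have "\<exists>s. foata (concat (map (support \<sigma>) (cycle_maxima n \<sigma>))) s
      (length (cycle_maxima n \<sigma>)) \<and>
      (\<forall>x\<in>(\<Union>m\<in>set (cycle_maxima n \<sigma>). orbit \<sigma> m). s x = \<sigma> x)"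
    by (rule foata_concat_support[OF p])
  then obtain s where s: "foata (fundamental_word n \<sigma>) s (num_cycles n \<sigma>)"
      "\<forall>x\<in>(\<Union>m\<in>set (cycle_maxima n \<sigma>). orbit \<sigma> m). s x = \<sigma> x"
    unfolding fundamental_word_def len by blast
  have "s permutes {1..n}"
    using foata_invariants[OF s(1)] fundamental_word_correct(2)[OF \<sigma>] by simp
  moreover have "s x = \<sigma> x" if "x \<in> {1..n}" for x
  proof -
    have "x \<in> orbit \<sigma> (Max (orbit \<sigma> x))"
      unfolding orbit_eq[OF p mx] by (rule permutation_self_in_orbit[OF p])
    then show ?thesis using s(2) that setM by blast
  qed
  \<comment> \<open>Both permutations fix everything outside \<open>{1..n}\<close>.\<close>
  ultimately have "s = \<sigma>"
    using \<sigma> by (intro ext) (metis permutes_not_in)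
  then show ?thesis using s(1) by simp
qed

section \<open>Passage from list positions to positions starting at 1, and conclusion\<close>

lemma card_pairs_shift:
  "card {(i, j). 1 \<le> i \<and> i < j \<and> j + 1 \<le> n \<and> Q i j} = card (pairs n (\<lambda>i j. Q (Suc i) (Suc j)))"
proof -
  have "{(i, j). 1 \<le> i \<and> i < j \<and> j + 1 \<le> n \<and> Q i j} =
      map_prod Suc Suc ` pairs n (\<lambda>i j. Q (Suc i) (Suc j))"
  proof (intro set_eqI iffI)
    fix x assume x: "x \<in> {(i, j). 1 \<le> i \<and> i < j \<and> j + 1 \<le> n \<and> Q i j}"
    obtain i j where ij: "x = (i, j)" by (cases x)
    with x have "x = map_prod Suc Suc (i - 1, j - 1)"
      "(i - 1, j - 1) \<in> pairs n (\<lambda>i j. Q (Suc i) (Suc j))"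
      by (auto simp: pairs_def)
    then show "x \<in> map_prod Suc Suc ` pairs n (\<lambda>i j. Q (Suc i) (Suc j))" by blast
  qed (auto simp: pairs_def)
  moreover have "inj_on (map_prod Suc Suc) (pairs n (\<lambda>i j. Q (Suc i) (Suc j)))"
    by (auto simp: inj_on_def)
  ultimately show ?thesis by (simp add: card_image)
qed

theorem theorem4p5:
  fixes n :: nat and \<sigma> \<tau> :: "nat \<Rightarrow> nat"
  assumes "\<sigma> permutes {1..n}"
    and "\<tau> = fundamental_bij n \<sigma>"
  shows "len_S n \<sigma> = len_T n \<sigma> + 2 * (pat_2_31 n \<tau> + pat_41_32 n \<tau> + stat_B n \<sigma> \<tau>)"
proof -
  let ?w = "fundamental_word n \<sigma>"
  note w = fundamental_word_correct[OF assms(1)]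
  have len: "length ?w = n" using distinct_card[OF w(1)] w(2) by simp
  have \<tau>: "\<tau> (Suc i) = ?w ! i" if "i < n" for i
    using that by (simp add: assms(2) fundamental_bij_def)
  have "pat_2_31 n \<tau> = word_2_31 ?w"
    unfolding pat_2_31_def word_2_31_def card_pairs_shift len
    by (rule card_pairs_cong) (simp add: \<tau>)
  moreover have "pat_41_32 n \<tau> = word_41_32 ?w"
  proof -
    \<comment> \<open>\<open>i + 1 = j\<close> is already excluded by \<open>\<tau> (i + 1) < \<tau> (j + 1) < \<tau> j\<close>.\<close>
    have "pat_41_32 n \<tau> = card {(i, j). 1 \<le> i \<and> i < j \<and> j + 1 \<le> n \<and>
        \<tau> (i + 1) < \<tau> (j + 1) \<and> \<tau> (j + 1) < \<tau> j \<and> \<tau> j < \<tau> i}"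
      unfolding pat_41_32_def
      by (rule arg_cong[where f = card]) (auto simp: Suc_less_eq2 less_Suc_eq dest: Suc_lessI)
    also have "\<dots> = word_41_32 ?w"
      unfolding word_41_32_def card_pairs_shift len
      by (rule card_pairs_cong) (simp add: \<tau>)
    finally show ?thesis .
  qed
  moreover have "stat_B n \<sigma> \<tau> = word_B ?w \<sigma>"
    unfolding stat_B_def word_B_def card_pairs_shift len
    by (rule card_pairs_cong) (simp add: \<tau>)
  moreover have "len_S n \<sigma> = inv_on (set ?w) \<sigma>"
    unfolding len_S_def inv_on_def w(2) by (rule arg_cong[where f = card]) auto
  \<comment> \<open>This makes the subtraction in \<open>len_T\<close> exact.\<close>
  moreover have "num_cycles n \<sigma> \<le> n"
    unfolding num_cycles_def using card_image_le[of "{1..n}" "orbit \<sigma>"] by simp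
  ultimately show ?thesis
    using foata_inv[OF foata_fundamental_word[OF assms(1)]] len by (simp add: len_T_def)
qed

end
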